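(* Let $X$ be a partially ordered normed space whose ordering cone $\mathcal{C}$ is closed, convex and pointed, let $x_0\in A\subset X$, $\varepsilon\ge0$, and $D\in\overline{\mathcal{H}}$. Assume that $(-\mathcal{C},\ \overline{\mathrm{cone}}(A-x_0+D(\varepsilon)))$ has the strict separation property (SSP). Then $x_0\in\mathrm{Be}(A,\mathcal{C},D,\varepsilon)$ if and only if there exists $(f,\alpha)\in\mathcal{C}^{a\#}_+$ such that $\min_{x\in(A+D(\varepsilon))\cup\{x_0\}}\ f(x-x_0)+\alpha\|x-x_0\|$ is attained only at $x_0$.
   Context: $X$ is a real normed space with origin $0_X$, dual $X^*$ and unit sphere $S_X$. For $S\subset X$: $\overline S$ is the closure, $\mathrm{bd}(S)$ the boundary, $\mathrm{co}(S)$ the convex hull, $S_0:=S\cup\{0_X\}$, $\mathrm{cone}(S):=\{\lambda s:\lambda\ge0,\ s\in S\}$ and $\overline{\mathrm{cone}}(S)$ is its closure. A cone is a set closed under multiplication by all $\lambda\ge0$; all cones considered are assumed non-trivial (different from $\{0_X\}$ and $X$). Pointed means $(-\mathcal{C})\cap\mathcal{C}=\{0_X\}$. For non-empty $D\subset X\setminus\{0_X\}$: $D(\varepsilon):=\varepsilon D$ if $\varepsilon>0$, and $D(0):=\mathrm{cone}(D)\setminus\{0_X\}$. $\overline{\mathcal{H}}:=\{\emptyset\ne D\subset X\setminus\{0_X\}:\overline{\mathrm{cone}}(D)\cap(-\mathcal{C})=\{0_X\}\}$. $x_0\in\mathrm{Be}(A,\mathcal{C},D,\varepsilon)$ (Benson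 $(D,\varepsilon)$-efficient point) means $x_0\in A$ and $\overline{\mathrm{cone}}(A+D(\varepsilon)-x_0)\cap(-\mathcal{C})=\{0_X\}$. For a cone $\mathcal{C}$, $\mathcal{C}_{\wedge}:=\mathrm{co}(\mathcal{C}\cap S_X)$ and $\mathcal{C}_{\vee}:=\mathrm{co}((\mathrm{bd}(\mathcal{C})\cap S_X)_0)$. The pair of cones $(\mathcal{C},\mathcal{K})$ has the strict separation property (SSP) if $0_X\notin\overline{\mathcal{C}_{\wedge}-\mathcal{K}_{\vee}}$ (Minkowski difference). $\mathcal{C}^{\#}:=\{f\in X^*: f(x)>0\ \forall x\in\mathcal{C},\ x\neq0_X\}$ and $\mathcal{C}^{a\#}_+:=\{(f,\alpha)\in\mathcal{C}^{\#}\times(0,\infty): f(x)-\alpha\|x\|>0\ \forall x\in\mathcal{C},\ x\neq0_X\}$. *)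

theory Defs
  imports "HOL-Analysis.Analysis" "HOL-Library.Set_Algebras"
begin

text \<open>
  The cone generated by \<open>S\<close> is the library's \<open>cone hull S\<close>; by \<open>cone_hull_expl\<close> it is the set of
  all \<open>c *\<^sub>R s\<close> with \<open>c \<ge> 0\<close> and \<open>s \<in> S\<close>. The sum \<open>A + B\<close> of two sets is the Minkowski sum of
  \<open>Set_Algebras\<close>, whereas \<open>A - B\<close> on sets is set difference, so that translates and
  Minkowski differences are written out explicitly.
\<close>

definition nontrivial_cone :: "'a::real_normed_vector set \<Rightarrow> bool" where
  "nontrivial_cone C \<longleftrightarrow> cone C \<and> C \<noteq> {} \<and> C \<noteq> {0} \<and> C \<noteq> UNIV"

definition pointed :: "'a::real_normed_vector set \<Rightarrow> bool" where
  "pointed C \<longleftrightarrow> uminus ` C \<inter> C = {0}"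

definition dilation :: "'a::real_normed_vector set \<Rightarrow> real \<Rightarrow> 'a set" where
  "dilation D \<epsilon> = (if \<epsilon> > 0 then (\<lambda>d. \<epsilon> *\<^sub>R d) ` D else cone hull D - {0})"
  \<comment> \<open>only used for \<open>\<epsilon> \<ge> 0\<close>, so that the second case is \<open>\<epsilon> = 0\<close>\<close>

definition H_bar :: "'a::real_normed_vector set \<Rightarrow> 'a set set" where
  "H_bar C = {D. D \<noteq> {} \<and> D \<subseteq> UNIV - {0} \<and> closure (cone hull D) \<inter> uminus ` C = {0}}"

definition benson ::
  "'a::real_normed_vector set \<Rightarrow> 'a set \<Rightarrow> 'a set \<Rightarrow> real \<Rightarrow> 'a set" where
  "benson A C D \<epsilon> =
    {x0 \<in> A. closure (cone hull ((\<lambda>y. y - x0) ` (A + dilation D \<epsilon>))) \<inter> uminus ` C = {0}}"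

definition cone_wedge :: "'a::real_normed_vector set \<Rightarrow> 'a set" where
  "cone_wedge C = convex hull (C \<inter> sphere 0 1)"

definition cone_vee :: "'a::real_normed_vector set \<Rightarrow> 'a set" where
  "cone_vee C = convex hull (insert 0 (frontier C \<inter> sphere 0 1))"

text \<open>
  Strict separation is a property of pairs of cones, and cones are non-trivial by convention.
\<close>

definition strict_separation_property ::
  "'a::real_normed_vector set \<Rightarrow> 'a set \<Rightarrow> bool" where
  "strict_separation_property C K \<longleftrightarrow>
    nontrivial_cone C \<and> nontrivial_cone K \<and>
    0 \<notin> closure {u - v | u v. u \<in> cone_wedge C \<and> v \<in> cone_vee K}"

definition strictly_positive_dual ::
  "'a::real_normed_vector set \<Rightarrow> ('a \<Rightarrow>\<^sub>L real) set" where
  "strictly_positive_dual C = {f. \<forall>x\<in>C. x \<noteq> 0 \<longrightarrow> blinfun_apply f x > 0}"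

definition augmented_dual ::
  "'a::real_normed_vector set \<Rightarrow> (('a \<Rightarrow>\<^sub>L real) \<times> real) set" where
  "augmented_dual C =
    {(f, \<alpha>). f \<in> strictly_positive_dual C \<and> \<alpha> > 0 \<and>
       (\<forall>x\<in>C. x \<noteq> 0 \<longrightarrow> blinfun_apply f x - \<alpha> * norm x > 0)}"

end

theory Submission imports Defs
begin

text \<open>
  Only the existence of \<open>(f, \<alpha>)\<close> needs the separation property. Strong separation of
  \<open>cone_wedge (- C)\<close> from \<open>cone_vee K\<close>, where \<open>K\<close> is the closed cone generated by
  \<open>A + D(\<epsilon>) - x0\<close>, gives \<open>f\<close> and \<open>\<alpha> > 0\<close> such that \<open>g x = f x + \<alpha> * norm x\<close> is negative on
  \<open>- C\<close> and positive on the boundary of \<open>K\<close>, the origin excepted. If \<open>g k \<le> 0\<close> for a nonzero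
  \<open>k\<close> in \<open>K\<close>, then, \<open>g\<close> being convex, \<open>g \<le> 0\<close> on a segment from \<open>k\<close> to a point of \<open>- C\<close>
  outside \<open>K\<close>. The segment meets the boundary of \<open>K\<close>, necessarily at the origin, so
  \<open>k \<in> C\<close>, where \<open>g\<close> is positive.
\<close>

section \<open>Sublinear functionals and the Hahn-Banach theorem\<close>

text \<open>Homogeneity is an inequality, which infima inherit easily; for \<open>t > 0\<close> the
  converse follows by scaling back with \<open>1 / t\<close>.\<close>

definition sublinear :: "('a::real_vector \<Rightarrow> real) \<Rightarrow> bool" where
  "sublinear q \<longleftrightarrow> (\<forall>x y. q (x + y) \<le> q x + q y) \<and> (\<forall>t\<ge>0. \<forall>x. q (t *\<^sub>R x) \<le> t * q x)"

lemma sublinear_add: "sublinear q \<Longrightarrow> q (x + y) \<le> q x + q y"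
  by (simp add: sublinear_def)

lemma sublinear_scale_le: "sublinear q \<Longrightarrow> 0 \<le> t \<Longrightarrow> q (t *\<^sub>R x) \<le> t * q x"
  by (simp add: sublinear_def)

lemma sublinear_zero:
  assumes "sublinear q"
  shows "q 0 = 0"
  using sublinear_add[OF assms, of 0 0] sublinear_scale_le[OF assms, of 0 0] by simp

lemma sublinear_minus:
  assumes "sublinear q"
  shows "- q (- x) \<le> q x"
  using sublinear_add[OF assms, of x "- x"] sublinear_zero[OF assms] by simp

text \<open>
  The witness is the largest sublinear functional below \<open>q\<close> that is at most \<open>c\<close> on \<open>W\<close>.
\<close>

lemma sublinear_below_on_convex:
  fixes q :: "'a::real_vector \<Rightarrow> real"
  assumes q: "sublinear q" and W: "convex W" "W \<noteq> {}" and c: "\<And>w. w \<in> W \<Longrightarrow> - c \<le> q (- w)"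
  obtains q' where "sublinear q'" "q' \<le> q" "\<And>w. w \<in> W \<Longrightarrow> q' w \<le> c"
proof -
  \<comment> \<open>A sublinear \<open>r \<le> q\<close> that is at most \<open>c\<close> on
    \<open>W\<close> satisfies
    \<open>r x \<le> r (x - t *\<^sub>R w) + t * r w \<le> h x (t, w)\<close> for
    \<open>t \<ge> 0\<close> and \<open>w \<in> W\<close>; the witness is the infimum of these
    bounds.\<close>
  define h where "h x = (\<lambda>(t, w). q (x - t *\<^sub>R w) + t * c)" for x
  define I where "I = {0::real..} \<times> W"
  define q' where "q' x = (INF i\<in>I. h x i)" for x
  have I: "I \<noteq> {}" using W by (auto simp: I_def)
  \<comment> \<open>The hypothesis on \<open>c\<close> enters here: it makes the infimum finite,
    with a bound independent of \<open>t\<close> and \<open>w\<close>.\<close>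
  have lower: "- q (- x) \<le> h x i" if "i \<in> I" for x i
  proof -
    obtain t w where i: "i = (t, w)" "t \<ge> 0" "w \<in> W" using \<open>i \<in> I\<close> by (auto simp: I_def)
    have "- (t * c) \<le> t * q (- w)" using mult_left_mono[OF c[OF i(3)] i(2)] by simp
    also have "\<dots> = q (t *\<^sub>R - w)"
    proof (cases "t = 0")
      case False
      then have "q (- w) \<le> (1 / t) * q (t *\<^sub>R - w)"
        using sublinear_scale_le[OF q, of "1 / t" "t *\<^sub>R - w"] i(2) by simp
      then have "t * q (- w) \<le> q (t *\<^sub>R - w)" using False i(2) by (simp add: field_simps)
      then show ?thesis using sublinear_scale_le[OF q i(2), of "- w"] by linarith
    qed (simp add: sublinear_zero[OF q])
    also have "\<dots> \<le> q (x - t *\<^sub>R w) + q (- x)"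
      using sublinear_add[OF q, of "x - t *\<^sub>R w" "- x"] by simp
    finally show ?thesis by (simp add: h_def i(1))
  qed
  have bdd: "bdd_below (h x ` I)" for x
    by (rule bdd_belowI2[where m = "- q (- x)"]) (rule lower)
  have q'_le: "q' x \<le> h x i" if "i \<in> I" for x i
    unfolding q'_def by (rule cINF_lower[OF bdd that])
  have q'_ge: "m \<le> q' x" if "\<And>i. i \<in> I \<Longrightarrow> m \<le> h x i" for m x
    unfolding q'_def by (rule cINF_greatest[OF I that])
  have le_q: "q' x \<le> q x" for x
  proof -
    obtain w where "w \<in> W" using W by blast
    then have "(0, w) \<in> I" by (simp add: I_def)
    from q'_le[OF this, of x] show ?thesis by (simp add: h_def)
  qed
  have le_c: "q' w \<le> c" if "w \<in> W" for w
  proof -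
    have "(1, w) \<in> I" using that by (simp add: I_def)
    from q'_le[OF this, of w] show ?thesis by (simp add: h_def sublinear_zero[OF q])
  qed
  have h_add: "q' (x + y) \<le> h x i + h y j" if ij: "i \<in> I" "j \<in> I" for x y i j
  proof -
    obtain t w where i: "i = (t, w)" "t \<ge> 0" "w \<in> W" using ij by (auto simp: I_def)
    obtain s v where j: "j = (s, v)" "s \<ge> 0" "v \<in> W" using ij by (auto simp: I_def)
    \<comment> \<open>By convexity the sum is \<open>t + s\<close> times a weighted mean in
      \<open>W\<close>; when both weights vanish, any point of \<open>W\<close> serves.\<close>
    have "\<exists>u\<in>W. (t + s) *\<^sub>R u = t *\<^sub>R w + s *\<^sub>R v"
    proof (cases "t + s = 0")
      case True
      then have "t = 0" "s = 0" using i(2) j(2) by auto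
      then show ?thesis using i(3) by auto
    next
      case False
      have "(t / (t + s)) *\<^sub>R w + (s / (t + s)) *\<^sub>R v \<in> W"
        using False i j by (intro convexD[OF W(1)]) (auto simp: add_divide_distrib[symmetric])
      then show ?thesis
        using False by (intro bexI[of _ "(t / (t + s)) *\<^sub>R w + (s / (t + s)) *\<^sub>R v"])
          (auto simp: scaleR_add_right)
    qed
    then obtain u where u: "u \<in> W" "(t + s) *\<^sub>R u = t *\<^sub>R w + s *\<^sub>R v" by blast
    have "(t + s, u) \<in> I" using i j u by (simp add: I_def)
    moreover have "x + y - (t + s) *\<^sub>R u = (x - t *\<^sub>R w) + (y - s *\<^sub>R v)"
      unfolding u(2) by (simp add: algebra_simps)
    ultimately have "q' (x + y) \<le> q ((x - t *\<^sub>R w) + (y - s *\<^sub>R v)) + (t + s) * c"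
      using q'_le[of "(t + s, u)" "x + y"] unfolding h_def by (metis case_prod_conv)
    also have "\<dots> \<le> h x i + h y j"
      using sublinear_add[OF q, of "x - t *\<^sub>R w" "y - s *\<^sub>R v"]
      by (simp add: h_def i j algebra_simps)
    finally show ?thesis .
  qed
  have add: "q' (x + y) \<le> q' x + q' y" for x y
  proof -
    \<comment> \<open>The infima are taken one at a time, first over the index at \<open>y\<close>,
      then over the index at \<open>x\<close>.\<close>
    have "q' (x + y) - q' y \<le> h x i" if i: "i \<in> I" for i
    proof -
      have "q' (x + y) - h x i \<le> q' y"
        using h_add[OF i] by (intro q'_ge) (simp add: algebra_simps)
      then show ?thesis by linarith
    qed
    then have "q' (x + y) - q' y \<le> q' x" by (rule q'_ge)
    then show ?thesis by linarith
  qed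
  have scale: "q' (r *\<^sub>R x) \<le> r * q' x" if "r \<ge> 0" for r x
  proof (cases "r = 0")
    case True
    then show ?thesis using le_q[of 0] sublinear_zero[OF q] by simp
  next
    case False
    have "q' (r *\<^sub>R x) / r \<le> q' x"
    proof (rule q'_ge)
      fix i assume "i \<in> I"
      then obtain t w where i: "i = (t, w)" "t \<ge> 0" "w \<in> W" by (auto simp: I_def)
      \<comment> \<open>The factor \<open>r\<close> is absorbed by the parameter, since
        \<open>r * t\<close> is again admissible.\<close>
      have "(r * t, w) \<in> I" using i that by (simp add: I_def)
      from q'_le[OF this, of "r *\<^sub>R x"]
      have "q' (r *\<^sub>R x) \<le> q (r *\<^sub>R (x - t *\<^sub>R w)) + r * (t * c)"
        by (simp add: h_def algebra_simps)
      also have "\<dots> \<le> r * h x i"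
        using sublinear_scale_le[OF q that, of "x - t *\<^sub>R w"]
        by (simp add: h_def i algebra_simps)
      finally show "q' (r *\<^sub>R x) / r \<le> h x i"
        using False that by (simp add: field_simps)
    qed
    then show ?thesis using False that by (simp add: field_simps)
  qed
  show thesis
    using add scale le_q le_c by (intro that[of q']) (auto simp: sublinear_def le_fun_def)
qed

text \<open>A minimal sublinear functional is linear.\<close>

lemma hahn_banach_sublinear:
  fixes p :: "'a::real_vector \<Rightarrow> real"
  assumes p: "sublinear p"
  obtains f where "linear f" "f \<le> p"
proof -
  define Q where "Q = {q. sublinear q \<and> q \<le> p}"
  have "\<exists>m\<in>Q. \<forall>q\<in>Q. q \<le> m \<longrightarrow> q = m"
  \<comment> \<open>The order is reversed: Zorn's lemma then yields a minimal element, and the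
    pointwise infimum of a chain serves as its bound.\<close>
  proof (rule predicate_Zorn[where P = "\<lambda>a b. b \<le> a"])
    show "partial_order_on Q (relation_of (\<lambda>a b. b \<le> a) Q)"
      by (rule partial_order_on_relation_ofI) auto
    fix M assume M: "M \<in> Chains (relation_of (\<lambda>a b. b \<le> a) Q)"
    then have MQ: "M \<subseteq> Q" by (rule Chains_relation_of)
    have tot: "a \<le> b \<or> b \<le> a" if "a \<in> M" "b \<in> M" for a b
      using M that unfolding Chains_def relation_of_def by auto
    show "\<exists>u\<in>Q. \<forall>a\<in>M. u \<le> a"
    proof (cases "M = {}")
      case True
      then show ?thesis using p by (auto simp: Q_def)
    next
      case False
      define u where "u x = (INF q\<in>M. q x)" for x
      \<comment> \<open>The common upper bound \<open>p\<close> yields a lower bound common to the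
        whole chain.\<close>
      have "- p (- x) \<le> q x" if "q \<in> M" for q x
      proof -
        have "sublinear q" "q (- x) \<le> p (- x)" using that MQ by (auto simp: Q_def le_fun_def)
        then show ?thesis using sublinear_minus[of q x] by linarith
      qed
      then have bdd: "bdd_below ((\<lambda>q. q x) ` M)" for x
        by (rule bdd_belowI2)
      have u_le: "u x \<le> q x" if "q \<in> M" for q x
        unfolding u_def by (rule cINF_lower[OF bdd that])
      have u_ge: "m \<le> u x" if "\<And>q. q \<in> M \<Longrightarrow> m \<le> q x" for m x
        unfolding u_def by (rule cINF_greatest[OF False that])
      have sub: "sublinear q" if "q \<in> M" for q using that MQ by (auto simp: Q_def)
      \<comment> \<open>The smaller of \<open>q\<close> and \<open>r\<close> in the chain is a
        single sublinear functional that bounds both terms from below.\<close>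
      have pair: "u (x + y) \<le> q x + r y" if qr: "q \<in> M" "r \<in> M" for q r x y
      proof -
        obtain s where s: "s \<in> M" "s \<le> q" "s \<le> r" using tot[OF qr] qr by blast
        have "u (x + y) \<le> s x + s y"
          using u_le[OF s(1), of "x + y"] sublinear_add[OF sub[OF s(1)], of x y] by linarith
        then show ?thesis using s by (meson add_mono le_funD order_trans)
      qed
      have "u (x + y) \<le> u x + u y" for x y
      proof -
        have "u (x + y) - u y \<le> q x" if q: "q \<in> M" for q
        proof -
          have "u (x + y) - q x \<le> u y"
            using pair[OF q] by (intro u_ge) (simp add: algebra_simps)
          then show ?thesis by linarith
        qed
        then have "u (x + y) - u y \<le> u x" by (rule u_ge)
        then show ?thesis by linarith
      qed
      moreover have "u (t *\<^sub>R x) \<le> t * u x" if "t \<ge> 0" for t x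
      proof (cases "t = 0")
        case True
        obtain q where "q \<in> M" using False by blast
        then show ?thesis using u_le[of q 0] sublinear_zero[OF sub, of q] True by simp
      next
        case t: False
        have "u (t *\<^sub>R x) / t \<le> u x"
        proof (rule u_ge)
          fix q assume q: "q \<in> M"
          have "u (t *\<^sub>R x) \<le> t * q x"
            using u_le[OF q, of "t *\<^sub>R x"] sublinear_scale_le[OF sub[OF q] that, of x] by linarith
          then show "u (t *\<^sub>R x) / t \<le> q x" using t that by (simp add: field_simps)
        qed
        then show ?thesis using t that by (simp add: field_simps)
      qed
      moreover have "u \<le> p"
      proof -
        obtain q where "q \<in> M" using False by blast
        then show ?thesis using u_le MQ by (force simp: Q_def le_fun_def intro: order_trans)
      qed
      ultimately show ?thesis
        using u_le by (intro bexI[of _ u]) (auto simp: Q_def sublinear_def le_fun_def)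
    qed
  qed
  then obtain f where f: "sublinear f" "f \<le> p" and min: "\<And>q. sublinear q \<Longrightarrow> q \<le> f \<Longrightarrow> q = f"
    unfolding Q_def using order_trans by blast
  have odd: "f (- x) = - f x" for x
  proof -
    \<comment> \<open>For \<open>{- x}\<close> and the constant \<open>- f x\<close> the hypothesis
      reads \<open>f x \<le> f x\<close>; minimality then identifies \<open>q\<close> with
      \<open>f\<close>.\<close>
    obtain q where q: "sublinear q" "q \<le> f" "q (- x) \<le> - f x"
      by (rule sublinear_below_on_convex[OF f(1), of "{- x}" "- f x"]) auto
    then have "f (- x) \<le> - f x" using min by blast
    then show ?thesis using sublinear_minus[OF f(1), of x] by linarith
  qed
  have add: "f (x + y) = f x + f y" for x y
    using sublinear_add[OF f(1), of x y] sublinear_add[OF f(1), of "- x" "- y"]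
      odd[of x] odd[of y] odd[of "x + y"] by simp
  have pos: "f (t *\<^sub>R x) = t * f x" if "t \<ge> 0" for t x
    using sublinear_scale_le[OF f(1) that, of x] sublinear_scale_le[OF f(1) that, of "- x"]
      odd[of x] odd[of "t *\<^sub>R x"] by simp
  have "f (t *\<^sub>R x) = t * f x" for t x
    using pos[of t x] pos[of "- t" x] odd[of "t *\<^sub>R x"] by (cases "t \<ge> 0") auto
  then have "linear f" using add by (intro linearI) auto
  with f(2) show thesis by (rule that[rotated])
qed

text \<open>The norm is lowered to a sublinear functional that is at most \<open>- d\<close> on
  \<open>W\<close>; a linear functional below it is bounded because the norm dominates it.\<close>

lemma convex_norm_ge_separation:
  fixes W :: "'a::real_normed_vector set"
  assumes W: "convex W" "W \<noteq> {}" and d: "\<And>w. w \<in> W \<Longrightarrow> d \<le> norm w"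
  obtains f :: "'a \<Rightarrow>\<^sub>L real" where "\<And>w. w \<in> W \<Longrightarrow> blinfun_apply f w \<le> - d"
proof -
  have norm: "sublinear (norm :: 'a \<Rightarrow> real)"
    by (auto simp: sublinear_def norm_triangle_ineq)
  obtain q where q: "sublinear q" "q \<le> norm" "\<And>w. w \<in> W \<Longrightarrow> q w \<le> - d"
    by (rule sublinear_below_on_convex[OF norm W, of "- d"]) (use d in auto)
  obtain f where f: "linear f" "f \<le> q" by (rule hahn_banach_sublinear[OF q(1)])
  have le: "f x \<le> norm x" for x using f(2) q(2) by (meson le_funD order_trans)
  have "norm (f x) \<le> norm x * 1" for x
    using le[of x] le[of "- x"] linear_neg[OF f(1), of x] by simp
  then have "bounded_linear f"
    by (intro bounded_linear_intro[where K = 1]) (simp_all add: f(1) linear_add linear_scale)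
  then show thesis
    using f(2) q(3) by (intro that[of "Blinfun f"])
      (auto simp: bounded_linear_Blinfun_apply le_fun_def intro: order_trans)
qed

section \<open>Separation of cones by an augmented functional\<close>

text \<open>The differences form a convex set at positive distance from the origin, so some
  functional leaves a gap \<open>d\<close> between its values on \<open>U\<close> and on
  \<open>V\<close>.\<close>

lemma strong_separation:
  fixes U V :: "'a::real_normed_vector set"
  assumes UV: "convex U" "U \<noteq> {}" "convex V" "0 \<in> V"
    and sep: "0 \<notin> closure {u - v | u v. u \<in> U \<and> v \<in> V}"
  obtains f :: "'a \<Rightarrow>\<^sub>L real" and \<alpha> where "\<alpha> > 0"
    "\<And>u. u \<in> U \<Longrightarrow> blinfun_apply f u + \<alpha> < 0" "\<And>v. v \<in> V \<Longrightarrow> blinfun_apply f v + \<alpha> > 0"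
proof -
  define W where "W = {u - v | u v. u \<in> U \<and> v \<in> V}"
  have "W = (\<Union>x\<in>U. \<Union>y\<in>V. {x - y})" by (auto simp: W_def)
  then have "convex W" using convex_differences[OF UV(1,3)] by simp
  moreover have "W \<noteq> {}" using UV by (auto simp: W_def)
  moreover obtain d where d: "d > 0" "\<And>w. w \<in> W \<Longrightarrow> d \<le> norm w"
    using sep unfolding W_def[symmetric] closure_approachable by (force simp: not_less)
  ultimately obtain f :: "'a \<Rightarrow>\<^sub>L real" where "\<And>w. w \<in> W \<Longrightarrow> blinfun_apply f w \<le> - d"
    by (metis convex_norm_ge_separation)
  then have "blinfun_apply f (u - v) \<le> - d" if "u \<in> U" "v \<in> V" for u v
    using that unfolding W_def by blast
  then have f: "blinfun_apply f u + d \<le> blinfun_apply f v" if "u \<in> U" "v \<in> V" for u v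
    using that by (force simp: blinfun.diff_right)
  define m where "m = (INF v\<in>V. blinfun_apply f v)"
  obtain u0 where u0: "u0 \<in> U" using UV by blast
  have "bdd_below (blinfun_apply f ` V)"
    by (rule bdd_belowI2[where m = "blinfun_apply f u0 + d"]) (rule f[OF u0])
  then have m: "m \<le> blinfun_apply f v" if "v \<in> V" for v
    unfolding m_def using that by (rule cINF_lower)
  have m': "blinfun_apply f u + d \<le> m" if "u \<in> U" for u
    unfolding m_def using f[OF that] UV by (intro cINF_greatest) auto
  show thesis
  proof (rule that)
    \<comment> \<open>This shift puts zero in the middle of the gap; it is positive because
      \<open>0 \<in> V\<close> forces \<open>m \<le> 0\<close>.\<close>
    show "d / 2 - m > 0" using d(1) m[OF UV(4)] by simp
    show "blinfun_apply f u + (d / 2 - m) < 0" if "u \<in> U" for u using m'[OF that] d(1) by simp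
    show "blinfun_apply f v + (d / 2 - m) > 0" if "v \<in> V" for v using m[OF that] d(1) by simp
  qed
qed

text \<open>Scaling by \<open>c > 0\<close> maps \<open>K\<close> and its complement into
  themselves, hence also the two closures whose intersection is the frontier.\<close>

lemma frontier_cone_scaleR:
  fixes K :: "'a::real_normed_vector set"
  assumes K: "cone K" and c: "c > 0" and x: "x \<in> frontier K"
  shows "c *\<^sub>R x \<in> frontier K"
proof -
  have "(*\<^sub>R) c ` K \<subseteq> K" using K c by (auto simp: mem_cone)
  moreover have "(*\<^sub>R) c ` (- K) \<subseteq> - K"
  proof clarsimp
    fix y assume y: "y \<notin> K" "c *\<^sub>R y \<in> K"
    then have "(1 / c) *\<^sub>R c *\<^sub>R y \<in> K" using c by (intro mem_cone[OF K y(2)]) simp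
    then show False using y c by simp
  qed
  ultimately have "(*\<^sub>R) c ` closure K \<subseteq> closure K" "(*\<^sub>R) c ` closure (- K) \<subseteq> closure (- K)"
    by (simp_all add: closure_scaleR closure_mono)
  then show ?thesis using x unfolding frontier_closures by auto
qed

text \<open>Reduces the sign at \<open>x\<close> to a unit vector, where
  \<open>\<alpha> * norm x\<close> becomes the constant \<open>\<alpha>\<close> of the strong
  separation.\<close>

lemma normalized_augmented:
  fixes f :: "'a::real_normed_vector \<Rightarrow>\<^sub>L real"
  assumes "x \<noteq> 0"
  shows "blinfun_apply f x + \<alpha> * norm x = norm x * (blinfun_apply f ((1 / norm x) *\<^sub>R x) + \<alpha>)"
  using assms by (simp add: blinfun.scaleR_right field_simps)

text \<open>Normalized vectors of \<open>P\<close> and of the frontier of \<open>K\<close> lie in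
  the two separated convex hulls; the origin adjoined in \<open>cone_vee\<close> is what makes
  \<open>\<alpha>\<close> positive.\<close>

lemma augmented_separation:
  fixes P K :: "'a::real_normed_vector set"
  assumes ssp: "strict_separation_property P K"
  obtains f :: "'a \<Rightarrow>\<^sub>L real" and \<alpha> where "\<alpha> > 0"
    "\<And>x. x \<in> P \<Longrightarrow> x \<noteq> 0 \<Longrightarrow> blinfun_apply f x + \<alpha> * norm x < 0"
    "\<And>x. x \<in> frontier K \<Longrightarrow> x \<noteq> 0 \<Longrightarrow> blinfun_apply f x + \<alpha> * norm x > 0"
proof -
  have P: "cone P" "P \<noteq> {}" "P \<noteq> {0}" and K: "cone K"
    and sep: "0 \<notin> closure {u - v | u v. u \<in> cone_wedge P \<and> v \<in> cone_vee K}"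
    using ssp by (auto simp: strict_separation_property_def nontrivial_cone_def)
  have wedge: "(1 / norm x) *\<^sub>R x \<in> cone_wedge P" if "x \<in> P" "x \<noteq> 0" for x
    unfolding cone_wedge_def using that P(1) by (intro hull_inc) (auto simp: mem_cone)
  have vee: "(1 / norm x) *\<^sub>R x \<in> cone_vee K" if "x \<in> frontier K" "x \<noteq> 0" for x
    unfolding cone_vee_def
    using that frontier_cone_scaleR[OF K, of "1 / norm x" x] by (intro hull_inc) auto
  obtain p where "p \<in> P" "p \<noteq> 0" using P by blast
  then have ne: "cone_wedge P \<noteq> {}" using wedge by blast
  have "convex (cone_wedge P)" "convex (cone_vee K)" "0 \<in> cone_vee K"
    by (auto simp: cone_wedge_def cone_vee_def intro: hull_inc)
  then obtain f :: "'a \<Rightarrow>\<^sub>L real" and \<alpha> where f: "\<alpha> > 0"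
    "\<And>u. u \<in> cone_wedge P \<Longrightarrow> blinfun_apply f u + \<alpha> < 0"
    "\<And>v. v \<in> cone_vee K \<Longrightarrow> blinfun_apply f v + \<alpha> > 0"
    using strong_separation[OF _ ne _ _ sep] by metis
  show thesis
  proof (rule that[OF f(1)])
    show "blinfun_apply f x + \<alpha> * norm x < 0" if "x \<in> P" "x \<noteq> 0" for x
      unfolding normalized_augmented[OF that(2)]
      using f(2)[OF wedge[OF that]] that(2) by (intro mult_pos_neg) auto
    show "blinfun_apply f x + \<alpha> * norm x > 0" if "x \<in> frontier K" "x \<noteq> 0" for x
      unfolding normalized_augmented[OF that(2)]
      using f(3)[OF vee[OF that]] that(2) by (intro mult_pos_pos) auto
  qed
qed

lemma convex_on_augmented:
  fixes f :: "'a::real_normed_vector \<Rightarrow>\<^sub>L real"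
  assumes "\<alpha> \<ge> 0"
  shows "convex_on UNIV (\<lambda>x. blinfun_apply f x + \<alpha> * norm x)"
proof -
  have "convex_on UNIV (blinfun_apply f)"
    by (auto intro!: convex_onI simp: blinfun.add_right blinfun.scaleR_right)
  moreover have "convex_on UNIV (\<lambda>x::'a. norm x)"
    using convex_on_dist[of UNIV "0::'a"] by (simp add: dist_norm)
  ultimately show ?thesis using assms by (intro convex_on_add convex_on_cmul)
qed

lemma augmented_pos_on_cone:
  fixes C K :: "'a::real_normed_vector set"
  assumes C: "nontrivial_cone C" and disj: "K \<inter> uminus ` C = {0}"
    and ssp: "strict_separation_property (uminus ` C) K"
  obtains f :: "'a \<Rightarrow>\<^sub>L real" and \<alpha> where "(f, \<alpha>) \<in> augmented_dual C"
    "\<And>x. x \<in> K \<Longrightarrow> x \<noteq> 0 \<Longrightarrow> blinfun_apply f x + \<alpha> * norm x > 0"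
proof -
  obtain f :: "'a \<Rightarrow>\<^sub>L real" and \<alpha> where f: "\<alpha> > 0"
    "\<And>x. x \<in> uminus ` C \<Longrightarrow> x \<noteq> 0 \<Longrightarrow> blinfun_apply f x + \<alpha> * norm x < 0"
    "\<And>x. x \<in> frontier K \<Longrightarrow> x \<noteq> 0 \<Longrightarrow> blinfun_apply f x + \<alpha> * norm x > 0"
    using augmented_separation[OF ssp] by metis
  have C_pos: "blinfun_apply f x - \<alpha> * norm x > 0" if "x \<in> C" "x \<noteq> 0" for x
    using f(2)[of "- x"] that by (simp add: blinfun.minus_right)
  have norm_pos: "0 < \<alpha> * norm x" if "x \<noteq> 0" for x :: 'a using f(1) that by simp
  have "blinfun_apply f x > 0" if "x \<in> C" "x \<noteq> 0" for x
    using C_pos[OF that] norm_pos[OF that(2)] by linarith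
  then have "(f, \<alpha>) \<in> augmented_dual C"
    using C_pos f(1) by (simp add: augmented_dual_def strictly_positive_dual_def)
  moreover have "blinfun_apply f k + \<alpha> * norm k > 0" if k: "k \<in> K" "k \<noteq> 0" for k
  proof (rule ccontr)
    assume "\<not> ?thesis"
    then have k_le: "blinfun_apply f k + \<alpha> * norm k \<le> 0" by simp
    obtain c where c: "c \<in> C" "c \<noteq> 0" using C by (auto simp: nontrivial_cone_def)
    then have "- c \<notin> K" using disj by (metis IntI imageI neg_equal_0_iff_equal singletonD)
    then obtain b where b: "b \<in> closed_segment k (- c)" "b \<in> frontier K"
      using connected_Int_frontier[of "closed_segment k (- c)" K] k by blast
    obtain s where s: "0 \<le> s" "s \<le> 1" "b = (1 - s) *\<^sub>R k + s *\<^sub>R (- c)"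
      using b(1) by (auto simp: in_segment)
    have "blinfun_apply f b + \<alpha> * norm b \<le>
        (1 - s) * (blinfun_apply f k + \<alpha> * norm k)
        + s * (blinfun_apply f (- c) + \<alpha> * norm (- c))"
      unfolding s(3) using convex_onD[OF convex_on_augmented] f(1) s(1,2)
      by (metis UNIV_I order_less_imp_le)
    also have "\<dots> \<le> 0"
      using f(2)[of "- c"] c k_le s by (intro add_nonpos_nonpos[OF mult_nonneg_nonpos mult_nonneg_nonpos]) auto
    \<comment> \<open>A nonzero \<open>b\<close> on the frontier would have a positive value,
      against the bound just derived.\<close>
    finally have "b = 0" using f(3)[OF b(2)] by force
    then have eq: "(1 - s) *\<^sub>R k = s *\<^sub>R c" using s(3) by simp
    \<comment> \<open>For \<open>s = 1\<close> the equation would give \<open>c = 0\<close>;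
      otherwise \<open>k\<close> is a nonnegative multiple of \<open>c\<close>.\<close>
    have "s \<noteq> 1" using eq c by auto
    then have "k = (s / (1 - s)) *\<^sub>R c"
      using arg_cong[OF eq, of "\<lambda>z. (1 / (1 - s)) *\<^sub>R z"] by simp
    then have "k \<in> C" using C c s by (auto simp: nontrivial_cone_def mem_cone)
    then show False using C_pos[of k] norm_pos[of k] k k_le by simp
  qed
  ultimately show thesis by (rule that)
qed

text \<open>The points where the augmented functional is nonnegative form a closed cone, which
  contains \<open>G\<close> but no nonzero point of \<open>- C\<close>.\<close>

lemma augmented_dual_closed_cone_disjoint:
  fixes C G :: "'a::real_normed_vector set"
  assumes f: "(f, \<alpha>) \<in> augmented_dual C" and G: "G \<noteq> {}" and C: "0 \<in> C"
    and nonneg: "\<And>x. x \<in> G \<Longrightarrow> blinfun_apply f x + \<alpha> * norm x \<ge> 0"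
  shows "closure (cone hull G) \<inter> uminus ` C = {0}"
proof -
  let ?Q = "{x. blinfun_apply f x + \<alpha> * norm x \<ge> 0}"
  have "cone hull G \<subseteq> ?Q"
  proof
    fix x assume "x \<in> cone hull G"
    then obtain c g where x: "x = c *\<^sub>R g" "c \<ge> 0" "g \<in> G" by (auto simp: cone_hull_expl)
    have "blinfun_apply f x + \<alpha> * norm x = c * (blinfun_apply f g + \<alpha> * norm g)"
      using x(2) by (simp add: x(1) blinfun.scaleR_right algebra_simps)
    then show "x \<in> ?Q" using nonneg[OF x(3)] x(2) by simp
  qed
  moreover have "closed ?Q" by (intro closed_Collect_le continuous_intros)
  ultimately have Q: "closure (cone hull G) \<subseteq> ?Q" by (rule closure_minimal)
  have "x = 0" if x: "x \<in> closure (cone hull G)" "- x \<in> C" for x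
  proof (rule ccontr)
    assume "x \<noteq> 0"
    then have "blinfun_apply f (- x) - \<alpha> * norm (- x) > 0"
      using f x(2) by (auto simp: augmented_dual_def)
    then show False using Q x(1) by (auto simp: blinfun.minus_right)
  qed
  \<comment> \<open>The cone hull of an empty set would be empty, so \<open>G \<noteq> {}\<close> is
    what puts the origin here.\<close>
  moreover have "0 \<in> closure (cone hull G)"
    using G closure_subset by (metis cone_cone_hull cone_contains_0 cone_hull_empty_iff subsetD)
  ultimately show ?thesis using C by force
qed

section \<open>Benson efficiency\<close>

lemma dilation_nonempty:
  assumes "D \<in> H_bar C"
  shows "dilation D \<epsilon> \<noteq> {}"
proof -
  obtain d where "d \<in> D" "d \<noteq> 0" using assms by (auto simp: H_bar_def)
  then have "d \<in> cone hull D - {0}" by (simp add: hull_inc)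
  then show ?thesis using \<open>d \<in> D\<close> by (auto simp: dilation_def)
qed

text \<open>Equality with \<open>{x0}\<close> expresses attainment and uniqueness at once;
  \<open>x0\<close> is adjoined because it may lie outside \<open>S\<close>.\<close>

lemma is_arg_min_unique_iff:
  fixes g :: "'a \<Rightarrow> real"
  shows "{x. is_arg_min g (\<lambda>x. x \<in> S \<union> {x0}) x} = {x0} \<longleftrightarrow> (\<forall>x\<in>S. x \<noteq> x0 \<longrightarrow> g x0 < g x)"
proof
  assume L: "{x. is_arg_min g (\<lambda>x. x \<in> S \<union> {x0}) x} = {x0}"
  then have le: "g x0 \<le> g x" if "x \<in> S \<union> {x0}" for x
    using that by (auto simp: is_arg_min_linorder set_eq_iff)
  show "\<forall>x\<in>S. x \<noteq> x0 \<longrightarrow> g x0 < g x"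
  proof (intro ballI impI, rule ccontr)
    fix x assume x: "x \<in> S" "x \<noteq> x0" "\<not> g x0 < g x"
    then have "is_arg_min g (\<lambda>x. x \<in> S \<union> {x0}) x"
      using le by (fastforce simp: is_arg_min_linorder)
    then show False using L x(2) by blast
  qed
next
  assume R: "\<forall>x\<in>S. x \<noteq> x0 \<longrightarrow> g x0 < g x"
  show "{x. is_arg_min g (\<lambda>x. x \<in> S \<union> {x0}) x} = {x0}"
    using R by (force simp: is_arg_min_def)
qed

theorem corollary4p3:
  fixes C A D :: "'a::real_normed_vector set" and x0 :: 'a and \<epsilon> :: real
  assumes "nontrivial_cone C" and "closed C" and "convex C" and "pointed C"
    and "x0 \<in> A"
    and "\<epsilon> \<ge> 0"
    and "D \<in> H_bar C"
    and "strict_separation_property (uminus ` C)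
           (closure (cone hull ((\<lambda>a. a - x0) ` A + dilation D \<epsilon>)))"
  shows "x0 \<in> benson A C D \<epsilon> \<longleftrightarrow>
    (\<exists>(f, \<alpha>) \<in> augmented_dual C.
       {x. is_arg_min (\<lambda>x. blinfun_apply f (x - x0) + \<alpha> * norm (x - x0))
             (\<lambda>x. x \<in> (A + dilation D \<epsilon>) \<union> {x0}) x} = {x0})"
proof -
  define G where "G = (\<lambda>y. y - x0) ` (A + dilation D \<epsilon>)"
  \<comment> \<open>The separation hypothesis translates \<open>A\<close> before adding the
    dilation, Benson efficiency translates the sum; the sets agree.\<close>
  have "(\<lambda>a. a - x0) ` A + dilation D \<epsilon> = G"
    by (force simp: G_def set_plus_def algebra_simps)
  with assms(8) have ssp: "strict_separation_property (uminus ` C) (closure (cone hull G))"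
    by simp
  have benson: "x0 \<in> benson A C D \<epsilon> \<longleftrightarrow> closure (cone hull G) \<inter> uminus ` C = {0}"
    using assms(5) by (simp add: benson_def G_def)
  have G: "G \<noteq> {}"
    using assms(5) dilation_nonempty[OF assms(7), of \<epsilon>] by (auto simp: G_def set_plus_def)
  have C0: "0 \<in> C" using assms(1) cone_contains_0 by (auto simp: nontrivial_cone_def)
  \<comment> \<open>The objective vanishes at \<open>x0\<close>, so after translation a unique
    minimum there means positivity on \<open>G\<close> away from the origin.\<close>
  have min: "{x. is_arg_min (\<lambda>x. blinfun_apply f (x - x0) + \<alpha> * norm (x - x0))
             (\<lambda>x. x \<in> (A + dilation D \<epsilon>) \<union> {x0}) x} = {x0} \<longleftrightarrow>
      (\<forall>x\<in>G. x \<noteq> 0 \<longrightarrow> blinfun_apply f x + \<alpha> * norm x > 0)" for f \<alpha>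
    unfolding is_arg_min_unique_iff by (simp add: G_def blinfun.zero_right)
  show ?thesis
    unfolding benson min
  proof
    assume "closure (cone hull G) \<inter> uminus ` C = {0}"
    then obtain f \<alpha> where "(f, \<alpha>) \<in> augmented_dual C"
      "\<And>x. x \<in> closure (cone hull G) \<Longrightarrow> x \<noteq> 0 \<Longrightarrow> blinfun_apply f x + \<alpha> * norm x > 0"
      using augmented_pos_on_cone[OF assms(1) _ ssp] by blast
    then show "\<exists>(f, \<alpha>)\<in>augmented_dual C. \<forall>x\<in>G. x \<noteq> 0 \<longrightarrow> blinfun_apply f x + \<alpha> * norm x > 0"
      using subsetD[OF closure_subset hull_inc] by blast
  next
    assume "\<exists>(f, \<alpha>)\<in>augmented_dual C. \<forall>x\<in>G. x \<noteq> 0 \<longrightarrow> blinfun_apply f x + \<alpha> * norm x > 0"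
    then obtain f \<alpha> where f: "(f, \<alpha>) \<in> augmented_dual C"
      and pos: "\<forall>x\<in>G. x \<noteq> 0 \<longrightarrow> blinfun_apply f x + \<alpha> * norm x > 0" by blast
    \<comment> \<open>The origin may belong to \<open>G\<close>, so only the weak inequality holds
      on all of it; that suffices for the closed cone.\<close>
    have "blinfun_apply f x + \<alpha> * norm x \<ge> 0" if "x \<in> G" for x
      using pos that by (cases "x = 0") (auto simp: blinfun.zero_right less_imp_le)
    then show "closure (cone hull G) \<inter> uminus ` C = {0}"
      by (rule augmented_dual_closed_cone_disjoint[OF f G C0])
  qed
qed

end
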